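(* Let $L\phi=-\phi''$ with $$\operatorname{Dom}L=\left\{\phi\in C^2[0,1]:\int_0^1K(y)\phi(y)\,dy=0=\phi'(1)\right\},$$ and let $F,F^{-1}$ be the transforms defined in the context. There exists a remainder transform $R$ (assigning to each $\phi\in\operatorname{Dom}L$ a function $R[\phi]$ on $\mathbb R\cup\partial D_\rho^+\cup\partial D_\rho^-$) for which, for all $\lambda\in\mathbb R\cup\partial D_\rho^+\cup\partial D_\rho^-$ and all $\phi\in\operatorname{Dom}L$, $$F[L\phi](\lambda)=\lambda^2F[\phi](\lambda)+R[\phi](\lambda).$$ Moreover, if $q:[0,1]\times[0,T]\to\mathbb C$ is such that, for all $t\in[0,T]$, $q(\cdot,t)\in\operatorname{Dom}L$, and $q$ is sufficiently smooth in $t$ in the sense given in the context, then, for all $t\in[0,T]$ and all $x\in(0,1)$, $$F^{-1}\left[\lambda\mapsto\int_0^te^{\lambda^2(s-t)}R[q](\lambda;s)\,ds\right](x)=0,$$ where $R[q](\lambda;s)=R[q(\cdot,s)](\lambda)$.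
   Context: $T>0$. $K:[0,1]\to\mathbb R$ is a fixed function which is supported in a neighbourhood of $0$, meaning that there is $\delta>0$ with $K(y)\neq0$ for all $y\in[0,\delta)$, and globally sufficiently smooth, meaning $K\in C^1[0,1]$. Define, for $\lambda\in\mathbb C$ and continuous $\phi:[0,1]\to\mathbb C$, $$\Delta(\lambda)=\int_0^1K(y)\cos([1-y]\lambda)\,dy,$$ $$\zeta^+(\lambda;\phi)=\int_0^1K(y)\cos([1-y]\lambda)\int_0^ye^{-i\lambda z}\phi(z)\,dz\,dy+\int_0^1K(y)e^{-i\lambda y}\int_y^1\cos([1-z]\lambda)\phi(z)\,dz\,dy,$$ $$\zeta^-(\lambda;\phi)=i\int_0^1K(y)\int_y^1\sin([z-y]\lambda)\phi(z)\,dz\,dy.$$ Let $\mathbb C^\pm$ be the open upper/lower half plane, let $\rho>0$ be so large that every zero $\lambda$ of $\Delta$ satisfies $|\operatorname{Im}\lambda|<\rho/\sqrt2$ (such $\rho$ exists), and let $D_\rho^\pm=\{\lambda\in\mathbb C^\pm:\operatorname{Re}(\lambda^2)<0,\ |\lambda|>\rho\}$. The contour $\partial D_\rho^\pm$ is the boundary of $D_\rho^\pm$, positively oriented (the region lies to the left); $\mathbb R$ is oriented in the increasing sense. For continuous $\phi:[0,1]\to\mathbb C$, $$F[\phi](\lambda)=\begin{cases}\int_0^1e^{-i\lambda y}\phi(y)\,dy&\lambda\in\mathbb R,\\ -\zeta^+(\lambda;\phi)/\Delta(\lambda)&\lambda\in\partial D_\rho^+,\\ -e^{-i\lambda}\zeta^-(\lambda;\phi)/\Delta(\lambda)&\lambda\in\partial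 D_\rho^-,\end{cases}\qquad F^{-1}[f](x)=\frac1{2\pi}\int_{\mathbb R\cup\partial D_\rho^+\cup\partial D_\rho^-}e^{i\lambda x}f(\lambda)\,d\lambda ,$$ where the integral over the union is the sum of the integrals over the three contours, each integral over an unbounded contour being improper, understood as the limit as $N\to\infty$ of the integral over the part of the contour with $|\lambda|\leq N$. "$q$ sufficiently smooth in $t$" means: $q,\ \partial_xq,\ \partial_tq,\ \partial_t\partial_xq$ exist and are continuous on $[0,1]\times[0,T]$. *)

theory Defs
  imports "HOL-Complex_Analysis.Complex_Analysis"
begin

section \<open>Functions on the unit interval\<close>

text \<open>Functions on $[0,1]$ are represented by total functions on the reals of which only the
  restriction to \<open>{0..1}\<close> matters. Derivatives are therefore taken within \<open>{0..1}\<close>, so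
  that they are one-sided at the endpoints.\<close>

definition D1 :: "(real \<Rightarrow> 'a::real_normed_vector) \<Rightarrow> real \<Rightarrow> 'a" where
  "D1 \<phi> x = vector_derivative \<phi> (at x within {0..1})"

definition C1_unit :: "(real \<Rightarrow> 'a::real_normed_vector) \<Rightarrow> bool" where
  "C1_unit \<phi> \<longleftrightarrow> \<phi> differentiable_on {0..1} \<and> continuous_on {0..1} (D1 \<phi>)"

definition C2_unit :: "(real \<Rightarrow> 'a::real_normed_vector) \<Rightarrow> bool" where
  "C2_unit \<phi> \<longleftrightarrow> C1_unit \<phi> \<and> C1_unit (D1 \<phi>)"

definition L :: "(real \<Rightarrow> complex) \<Rightarrow> real \<Rightarrow> complex" where
  "L \<phi> x = - D1 (D1 \<phi>) x"

definition Dom_L :: "(real \<Rightarrow> real) \<Rightarrow> (real \<Rightarrow> complex) set" where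
  "Dom_L K = {\<phi>. C2_unit \<phi> \<and> integral {0..1} (\<lambda>y. of_real (K y) * \<phi> y) = 0 \<and> D1 \<phi> 1 = 0}"

definition smooth_in_t :: "real \<Rightarrow> (real \<Rightarrow> real \<Rightarrow> complex) \<Rightarrow> bool" where
  "smooth_in_t T q \<longleftrightarrow> (\<exists>qx qt qtx.
     (\<forall>x\<in>{0..1}. \<forall>t\<in>{0..T}.
        ((\<lambda>x'. q x' t) has_vector_derivative qx x t) (at x within {0..1}) \<and>
        ((\<lambda>t'. q x t') has_vector_derivative qt x t) (at t within {0..T}) \<and>
        ((\<lambda>t'. qx x t') has_vector_derivative qtx x t) (at t within {0..T})) \<and>
     continuous_on ({0..1} \<times> {0..T}) (\<lambda>(x, t). q x t) \<and>
     continuous_on ({0..1} \<times> {0..T}) (\<lambda>(x, t). qx x t) \<and>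
     continuous_on ({0..1} \<times> {0..T}) (\<lambda>(x, t). qt x t) \<and>
     continuous_on ({0..1} \<times> {0..T}) (\<lambda>(x, t). qtx x t))"


section \<open>The functions \<open>\<Delta>\<close> and \<open>\<zeta>\<^sup>\<plusminus>\<close>\<close>

definition Delta :: "(real \<Rightarrow> real) \<Rightarrow> complex \<Rightarrow> complex" where
  "Delta K w = integral {0..1} (\<lambda>y. of_real (K y) * cos (of_real (1 - y) * w))"

definition zeta_plus :: "(real \<Rightarrow> real) \<Rightarrow> (real \<Rightarrow> complex) \<Rightarrow> complex \<Rightarrow> complex" where
  "zeta_plus K \<phi> w =
     integral {0..1} (\<lambda>y. of_real (K y) * cos (of_real (1 - y) * w) *
       integral {0..y} (\<lambda>z. exp (- \<i> * w * of_real z) * \<phi> z)) +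
     integral {0..1} (\<lambda>y. of_real (K y) * exp (- \<i> * w * of_real y) *
       integral {y..1} (\<lambda>z. cos (of_real (1 - z) * w) * \<phi> z))"

definition zeta_minus :: "(real \<Rightarrow> real) \<Rightarrow> (real \<Rightarrow> complex) \<Rightarrow> complex \<Rightarrow> complex" where
  "zeta_minus K \<phi> w =
     \<i> * integral {0..1} (\<lambda>y. of_real (K y) *
       integral {y..1} (\<lambda>z. sin (of_real (z - y) * w) * \<phi> z))"


section \<open>The contours\<close>

definition D_plus :: "real \<Rightarrow> complex set" where
  "D_plus \<rho> = {w. Im w > 0 \<and> Re (w\<^sup>2) < 0 \<and> norm w > \<rho>}"

definition D_minus :: "real \<Rightarrow> complex set" where
  "D_minus \<rho> = {w. Im w < 0 \<and> Re (w\<^sup>2) < 0 \<and> norm w > \<rho>}"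

definition Contour :: "real \<Rightarrow> complex set" where
  "Contour \<rho> = \<real> \<union> frontier (D_plus \<rho>) \<union> frontier (D_minus \<rho>)"

text \<open>Parametrisations of the parts of the three contours lying in the disc of radius \<open>N\<close>
  about \<open>0\<close>, for \<open>N \<ge> \<rho>\<close>. The region \<open>D_plus \<rho>\<close> is the sector
  $\pi/4 < \arg w < 3\pi/4$ without the closed disc of radius \<open>\<rho>\<close>: with the region to
  the left, its boundary comes in along the ray of argument $3\pi/4$, follows the arc clockwise,
  and goes out along the ray of argument $\pi/4$. The contour around \<open>D_minus \<rho>\<close> is this
  one rotated by $\pi$.\<close>

definition real_path :: "real \<Rightarrow> real \<Rightarrow> complex" where
  "real_path N = linepath (- of_real N) (of_real N)"

definition plus_path :: "real \<Rightarrow> real \<Rightarrow> real \<Rightarrow> complex" where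
  "plus_path \<rho> N =
     linepath (of_real N * cis (3 * pi / 4)) (of_real \<rho> * cis (3 * pi / 4)) +++
     part_circlepath 0 \<rho> (3 * pi / 4) (pi / 4) +++
     linepath (of_real \<rho> * cis (pi / 4)) (of_real N * cis (pi / 4))"

definition minus_path :: "real \<Rightarrow> real \<Rightarrow> real \<Rightarrow> complex" where
  "minus_path \<rho> N =
     linepath (of_real N * cis (7 * pi / 4)) (of_real \<rho> * cis (7 * pi / 4)) +++
     part_circlepath 0 \<rho> (7 * pi / 4) (5 * pi / 4) +++
     linepath (of_real \<rho> * cis (5 * pi / 4)) (of_real N * cis (5 * pi / 4))"

text \<open>The parametrised paths trace exactly the truncated boundaries:
  \<open>path_image_plus_path\<close> and \<open>path_image_minus_path\<close> below.\<close>

lemma D_plus_iff: "w \<in> D_plus \<rho> \<longleftrightarrow> \<bar>Re w\<bar> < Im w \<and> \<rho> < norm w"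
proof -
  have "(Re w)\<^sup>2 < (Im w)\<^sup>2 \<longleftrightarrow> \<bar>Re w\<bar> < \<bar>Im w\<bar>"
    by (metis abs_le_square_iff linorder_not_le)
  then show ?thesis by (auto simp: D_plus_def power2_eq_square)
qed

lemma closure_D_plus:
  assumes "\<rho> > 0"
  shows "closure (D_plus \<rho>) = {w. \<bar>Re w\<bar> \<le> Im w \<and> \<rho> \<le> norm w}" (is "_ = ?S")
proof
  have "closed {w. \<bar>Re w\<bar> \<le> Im w}" by (intro closed_Collect_le continuous_intros)
  moreover have "closed {w::complex. \<rho> \<le> norm w}" by (intro closed_Collect_le continuous_intros)
  ultimately have "closed ({w. \<bar>Re w\<bar> \<le> Im w} \<inter> {w. \<rho> \<le> norm w})" by blast
  then have "closed ?S" by (simp add: Collect_conj_eq)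
  then show "closure (D_plus \<rho>) \<subseteq> ?S"
    by (intro closure_minimal) (auto simp: D_plus_iff)
  show "?S \<subseteq> closure (D_plus \<rho>)"
  proof
    fix w assume w: "w \<in> ?S"
    have "\<exists>y\<in>D_plus \<rho>. dist y w < e" if "e > 0" for e
    proof -
      define y where "y = w + \<i> * of_real (e/2)"
      have "(cmod w)\<^sup>2 < (cmod y)\<^sup>2"
      proof -
        have "(Im w)\<^sup>2 < (Im w + e/2)\<^sup>2" using w that by (intro power_strict_mono) auto
        then show ?thesis by (simp add: y_def cmod_power2)
      qed
      then have "cmod w < cmod y" by (rule power_less_imp_less_base) simp
      then have "y \<in> D_plus \<rho>" using w that by (auto simp: D_plus_iff y_def)
      moreover have "dist y w < e" using that by (simp add: y_def dist_norm norm_mult)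
      ultimately show ?thesis by blast
    qed
    then show "w \<in> closure (D_plus \<rho>)" by (simp add: closure_approachable)
  qed
qed

lemma frontier_D_plus:
  assumes "\<rho> > 0"
  shows "frontier (D_plus \<rho>) =
    {w. \<bar>Re w\<bar> \<le> Im w \<and> \<rho> \<le> norm w \<and> (\<bar>Re w\<bar> = Im w \<or> norm w = \<rho>)}"
proof -
  have "open {w. \<bar>Re w\<bar> < Im w}" by (intro open_Collect_less continuous_intros)
  moreover have "open {w::complex. \<rho> < norm w}" by (intro open_Collect_less continuous_intros)
  ultimately have "open ({w. \<bar>Re w\<bar> < Im w} \<inter> {w. \<rho> < norm w})" by blast
  moreover have "D_plus \<rho> = {w. \<bar>Re w\<bar> < Im w} \<inter> {w. \<rho> < norm w}"
    by (auto simp: D_plus_iff)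
  ultimately have "open (D_plus \<rho>)" by simp
  then show ?thesis
    unfolding frontier_def closure_D_plus[OF assms] interior_open[OF \<open>open (D_plus \<rho>)\<close>]
    by (auto simp: D_plus_iff)
qed

lemma segment_ray:
  fixes c :: complex assumes "a \<le> b"
  shows "closed_segment (of_real a * c) (of_real b * c) = {of_real r * c | r. a \<le> r \<and> r \<le> b}"
proof -
  have "(\<lambda>r. r *\<^sub>R c) ` closed_segment a b = closed_segment (a *\<^sub>R c) (b *\<^sub>R c)"
    by (rule closed_segment_linear_image[symmetric]) (simp add: bounded_linear.linear bounded_linear_scaleR_left)
  then have "closed_segment (of_real a * c) (of_real b * c) = (\<lambda>r. of_real r * c) ` {a..b}"
    using assms by (simp add: closed_segment_eq_real_ivl scaleR_conv_of_real)
  then show ?thesis by auto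
qed

lemma cis_vals: "Re (cis (pi/4)) = sqrt 2/2" "Im (cis (pi/4)) = sqrt 2/2"
  "Re (cis (3*pi/4)) = - sqrt 2/2" "Im (cis (3*pi/4)) = sqrt 2/2"
proof -
  have "3*pi/4 = pi - pi/4" by simp
  then have "cos (3*pi/4) = - sqrt 2/2" "sin (3*pi/4) = sqrt 2/2" 
    by (simp_all only: cos_pi_minus sin_pi_minus cos_45 sin_45)
  then show "Re (cis (pi/4)) = sqrt 2/2" "Im (cis (pi/4)) = sqrt 2/2"
  "Re (cis (3*pi/4)) = - sqrt 2/2" "Im (cis (3*pi/4)) = sqrt 2/2" by (simp_all add: cos_45 sin_45)
qed

lemma norm_diag: "\<bar>Re w\<bar> = Im w \<Longrightarrow> Im w = norm w * (sqrt 2 / 2)"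
proof -
  assume a: "\<bar>Re w\<bar> = Im w"
  then have "(Re w)\<^sup>2 = (Im w)\<^sup>2" by (metis power2_abs)
  then have "norm w = sqrt (2 * (Im w)\<^sup>2)" by (simp add: cmod_def)
  also have "\<dots> = sqrt 2 * Im w" using a by (simp add: real_sqrt_mult)
  finally show ?thesis by simp
qed

lemma path_image_plus_path:
  assumes "0 < \<rho>" "\<rho> \<le> N"
  shows "path_image (plus_path \<rho> N) = frontier (D_plus \<rho>) \<inter> cball 0 N" (is "?P = ?Q")
proof -
  let ?A = "{of_real r * cis (3*pi/4) | r. \<rho> \<le> r \<and> r \<le> N}"
  let ?B = "(\<lambda>x. of_real \<rho> * cis x) ` {pi/4..3*pi/4}"
  let ?C = "{of_real r * cis (pi/4) | r. \<rho> \<le> r \<and> r \<le> N}"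
  have fin: "pathfinish (part_circlepath 0 \<rho> (3 * pi / 4) (pi / 4)) = of_real \<rho> * cis (pi/4)"
    and st: "pathstart (part_circlepath 0 \<rho> (3 * pi / 4) (pi / 4)) = of_real \<rho> * cis (3*pi/4)"
    by (simp_all add: cis_conv_exp)
  have P: "?P = ?A \<union> ?B \<union> ?C"
    unfolding plus_path_def using assms
    by (subst path_image_join; (subst path_image_join)?)
      (simp_all del: pathstart_part_circlepath pathfinish_part_circlepath add: fin st path_image_part_circlepath' closed_segment_eq_real_ivl segment_ray[of \<rho> N]
        closed_segment_commute[of "of_real N * _"] Un_assoc)
  have sub: "?A \<union> ?B \<union> ?C \<subseteq> ?Q"
  proof -
    have "?A \<subseteq> ?Q" "?C \<subseteq> ?Q" using assms
      by (auto simp: frontier_D_plus norm_mult cis_vals simp del: cis.simps)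
    moreover have "?B \<subseteq> ?Q"
    proof clarify
      fix x assume x: "x \<in> {pi/4..3*pi/4}"
      have "\<bar>cos x\<bar> \<le> sin x"
      proof -
        have "sin (x - pi/4) \<ge> 0" "sin (x + pi/4) \<ge> 0" using x by (auto intro!: sin_ge_zero)
        then have "sqrt 2/2 * (sin x - cos x) \<ge> 0" "sqrt 2 / 2 * (sin x + cos x) \<ge> 0"
          by (simp_all add: sin_diff sin_add cos_45 sin_45 algebra_simps)
        then show ?thesis by (simp add: zero_le_mult_iff)
      qed
      then have "\<bar>\<rho> * cos x\<bar> \<le> \<rho> * sin x" using assms by (simp add: abs_mult)
      then show "of_real \<rho> * cis x \<in> ?Q" using assms
        by (simp add: frontier_D_plus norm_mult)
    qed
    ultimately show ?thesis by blast
  qed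
  have sup: "w \<in> ?A \<union> ?B \<union> ?C" if "w \<in> ?Q" for w
  proof -
    have w: "\<bar>Re w\<bar> \<le> Im w" "\<rho> \<le> norm w" "norm w \<le> N" "\<bar>Re w\<bar> = Im w \<or> norm w = \<rho>"
      using that assms by (auto simp: frontier_D_plus)
    show ?thesis
    proof (cases "\<bar>Re w\<bar> = Im w")
      case True
      then have "w = of_real (norm w) * cis (pi/4) \<or> w = of_real (norm w) * cis (3*pi/4)"
        using norm_diag[OF True] by (auto simp: complex_eq_iff cis_vals simp del: cis.simps)
      then show ?thesis using w by blast
    next
      case False
      then have n: "norm w = \<rho>" using w by blast
      define x where "x = arccos (Re w / \<rho>)"
      have r: "\<bar>Re w / \<rho>\<bar> \<le> sqrt 2 / 2"
      proof -
        have "2 * (Re w)\<^sup>2 \<le> \<rho>\<^sup>2"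
          using w(1) n power_mono[of "\<bar>Re w\<bar>" "Im w" 2] by (simp add: cmod_power2 flip: n)
        then have "\<bar>Re w / \<rho>\<bar>\<^sup>2 \<le> (sqrt 2/2)\<^sup>2"
          using assms by (simp add: power_divide field_simps)
        then show ?thesis by (rule power2_le_imp_le) simp
      qed
      have s2: "sqrt 2 / 2 \<le> 1" using sqrt2_less_2 by simp
      have r1: "- 1 \<le> Re w / \<rho>" "Re w / \<rho> \<le> 1" using r s2 by linarith+
      have "cos x = Re w / \<rho>" unfolding x_def using r1 by (rule cos_arccos)
      moreover have x0: "0 \<le> x" "x \<le> pi" unfolding x_def using r1 by (auto intro!: arccos_lbound arccos_ubound)
      ultimately have e: "Re w = \<rho> * cos x" using assms by simp
      have "(Im w)\<^sup>2 = \<rho>\<^sup>2 - (\<rho> * cos x)\<^sup>2" using n e cmod_power2[of w] by simp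
      also have "\<dots> = (\<rho> * sin x)\<^sup>2" by (simp add: sin_squared_eq algebra_simps)
      finally have "Im w = \<rho> * sin x"
      proof (rule power2_eq_imp_eq)
        show "0 \<le> Im w" using w(1) by linarith
        show "0 \<le> \<rho> * sin x" using assms(1) sin_ge_zero[OF x0] by simp
      qed
      then have "w = of_real \<rho> * cis x" using e by (simp add: complex_eq_iff)
      moreover have "pi/4 \<le> x"
      proof (rule ccontr)
        assume "\<not> ?thesis"
        then have "cos (pi/4) < cos x" using x0 by (intro cos_monotone_0_pi) auto
        then have "sqrt 2 / 2 < Re w / \<rho>" using \<open>cos x = _\<close> by (simp only: cos_45)
        then show False using r by linarith
      qed
      moreover have "x \<le> 3*pi/4"
      proof (rule ccontr)
        assume "\<not> ?thesis"
        then have "cos x < cos (3*pi/4)" using x0 by (intro cos_monotone_0_pi) auto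
        then have "Re w / \<rho> < - sqrt 2 / 2" using \<open>cos x = _\<close> cis_vals(3) by (simp only: cis.simps)
        then show False using r by linarith
      qed
      ultimately show ?thesis by auto
    qed
  qed
  show ?thesis unfolding P by (rule subset_antisym[OF sub subsetI[OF sup]])
qed

lemma D_minus_eq: "D_minus \<rho> = uminus ` D_plus \<rho>"
proof -
  have "w \<in> D_minus \<rho> \<longleftrightarrow> - w \<in> D_plus \<rho>" for w by (simp add: D_minus_def D_plus_def)
  then show ?thesis by force
qed

lemma minus_path_eq: "minus_path \<rho> N = uminus \<circ> plus_path \<rho> N"
proof -
  have a: "cis (7*pi/4) = - cis (3*pi/4)" "cis (5*pi/4) = - cis (pi/4)"
  proof -
    have "7*pi/4 = 3*pi/4 + pi" "5*pi/4 = pi/4+pi" by auto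
    then show "cis (7*pi/4) = - cis (3*pi/4)" "cis (5*pi/4) = - cis (pi/4)" by (simp_all only: complex_eq_iff cis.simps uminus_complex.simps sin_add cos_add) auto
  qed
  have "part_circlepath 0 \<rho> (7*pi/4) (5*pi/4) = uminus \<circ> part_circlepath 0 \<rho> (3*pi/4) (pi/4)"
  proof
    fix t
    have "linepath (7*pi/4) (5*pi/4) t = linepath (3*pi/4) (pi/4) t + pi"
      by (simp add: linepath_def field_simps)
    then show "part_circlepath 0 \<rho> (7*pi/4) (5*pi/4) t = (uminus \<circ> part_circlepath 0 \<rho> (3*pi/4) (pi/4)) t"
      by (simp add: part_circlepath_def distrib_left exp_add)
  qed
  then show ?thesis unfolding minus_path_def plus_path_def a
    by (auto simp: fun_eq_iff joinpaths_def linepath_def scaleR_conv_of_real)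
qed

lemma path_image_minus_path:
  assumes "0 < \<rho>" "\<rho> \<le> N"
  shows "path_image (minus_path \<rho> N) = frontier (D_minus \<rho>) \<inter> cball 0 N"
proof -
  have "frontier (uminus ` S) = uminus ` frontier S" for S :: "complex set"
    using closure_injective_linear_image[of uminus S] interior_injective_linear_image[of uminus S]
    by (auto simp: frontier_def linear_uminus image_set_diff)
  then have "frontier (D_minus \<rho>) \<inter> cball 0 N = uminus ` (frontier (D_plus \<rho>) \<inter> cball 0 N)"
    by (auto simp: D_minus_eq)
  then show ?thesis using path_image_plus_path[OF assms]
    by (metis minus_path_eq path_image_compose)
qed

definition has_improper_integral ::
    "(complex \<Rightarrow> complex) \<Rightarrow> complex \<Rightarrow> (real \<Rightarrow> real \<Rightarrow> complex) \<Rightarrow> bool" where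
  "has_improper_integral f I \<gamma> \<longleftrightarrow>
     (\<exists>J. (\<forall>\<^sub>F N in at_top. (f has_contour_integral J N) (\<gamma> N)) \<and> (J \<longlongrightarrow> I) at_top)"


section \<open>The transform pair\<close>

definition F :: "(real \<Rightarrow> real) \<Rightarrow> real \<Rightarrow> (real \<Rightarrow> complex) \<Rightarrow> complex \<Rightarrow> complex" where
  "F K \<rho> \<phi> w =
     (if w \<in> \<real> then integral {0..1} (\<lambda>y. exp (- \<i> * w * of_real y) * \<phi> y)
      else if w \<in> frontier (D_plus \<rho>) then - zeta_plus K \<phi> w / Delta K w
      else if w \<in> frontier (D_minus \<rho>) then
        - exp (- \<i> * w) * zeta_minus K \<phi> w / Delta K w
      else undefined)"

text \<open>\<open>has_F_inverse \<rho> f x v\<close>: the three improper integrals defining $F^{-1}[f](x)$ exist,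
  and $F^{-1}[f](x) = v$.\<close>

definition has_F_inverse ::
    "real \<Rightarrow> (complex \<Rightarrow> complex) \<Rightarrow> real \<Rightarrow> complex \<Rightarrow> bool" where
  "has_F_inverse \<rho> f x v \<longleftrightarrow>
     (\<exists>I\<^sub>0 I\<^sub>p I\<^sub>m.
        has_improper_integral (\<lambda>w. exp (\<i> * w * of_real x) * f w) I\<^sub>0 real_path \<and>
        has_improper_integral (\<lambda>w. exp (\<i> * w * of_real x) * f w) I\<^sub>p (plus_path \<rho>) \<and>
        has_improper_integral (\<lambda>w. exp (\<i> * w * of_real x) * f w) I\<^sub>m (minus_path \<rho>) \<and>
        v = 1 / (2 * of_real pi) * (I\<^sub>0 + I\<^sub>p + I\<^sub>m))"

end

theory Submission
  imports Defs "HOL-Real_Asymp.Real_Asymp"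
begin

text \<open>The remainder transform is forced: it has to be
  \<open>F[L \<phi>](\<lambda>) - \<lambda>\<^sup>2 F[\<phi>](\<lambda>)\<close>, and the content of the theorem is what this difference is.
  Every kernel in the definition of \<open>F\<close> is a solution \<open>u\<close> of \<open>u'' = - \<lambda>\<^sup>2 u\<close>, so
  Green's identity reduces the difference to boundary terms. In \<open>\<zeta>\<^sup>\<plusminus>\<close> these still contain
  \<open>\<phi>\<close> under the integral against \<open>K\<close>, but only in the combination
  \<open>\<integral> K \<phi>\<close>, which vanishes on the domain of \<open>L\<close>; what is left is a multiple of
  \<open>\<Delta>\<close>, and the denominator cancels. With \<open>A = \<phi>'(0)\<close>, \<open>B = \<phi>(0)\<close>,
  \<open>C = \<phi>(1)\<close> the remainder is
  \<open>A + i\<lambda>B - i\<lambda>e\<^sup>-\<^sup>i\<^sup>\<lambda>C\<close> on the real line,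
  \<open>- (A + i\<lambda>B)\<close> on the upper contour and
  \<open>- i\<lambda>e\<^sup>-\<^sup>i\<^sup>\<lambda>C\<close> on the lower one
  (\<open>remainder_real\<close>, \<open>remainder_plus\<close>, \<open>remainder_minus\<close>). Nothing of
  \<open>K\<close> or of its zeros is left: the remainder is a sum of two entire functions of \<open>\<lambda>\<close>.

  Each of these two functions occurs on two contours, and the contributions cancel by a contour
  deformation. The time integral \<open>G(\<lambda>) = \<integral>\<^sub>0\<^sup>t e\<^bsup>\<lambda>\<^sup>2(s-t)\<^esup> g(s) ds\<close>
  of a continuously differentiable \<open>g\<close> is entire, and an integration by parts gives
  \<open>G(\<lambda>) = O(\<bar>\<lambda>\<bar>\<^sup>-\<^sup>2)\<close> where \<open>Re (\<lambda>\<^sup>2) \<ge> 0\<close>, that is, on the region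
  between the real line and the two other contours (\<open>duhamel_decay\<close>). So
  \<open>P(\<lambda>) = \<integral>\<^sub>0\<^sup>t e\<^bsup>\<lambda>\<^sup>2(s-t)\<^esup> (A(s) + i\<lambda>B(s)) ds\<close> is
  \<open>O(\<bar>\<lambda>\<bar>\<^sup>-\<^sup>1)\<close> there. As \<open>e\<^sup>i\<^sup>\<lambda>\<^sup>x\<close> with \<open>x > 0\<close> decays
  exponentially along every ray into the upper half plane, an argument in the manner of Jordan's
  lemma shows that \<open>e\<^sup>i\<^sup>\<lambda>\<^sup>x P(\<lambda>)\<close> has convergent improper
  integrals over the real line and over the upper contour, and that these agree
  (\<open>improper_integrals_agree\<close>). The contour around the lower sector is minus the upper one
  and \<open>G\<close> is even, so the term with \<open>C\<close> is the same statement with \<open>1 - x > 0\<close> in place of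
  \<open>x\<close>.\<close>


section \<open>Green's identity on the domain of the operator\<close>

lemma C2_unit_derivatives:
  assumes "C2_unit \<phi>" "z \<in> {0..1}"
  shows "(\<phi> has_vector_derivative D1 \<phi> z) (at z within {0..1})"
    and "(D1 \<phi> has_vector_derivative - L \<phi> z) (at z within {0..1})"
  using assms
  by (auto simp: C2_unit_def C1_unit_def L_def differentiable_on_def D1_def[of \<phi> z]
      D1_def[of "D1 \<phi>" z] simp flip: vector_derivative_works)

lemma C2_unit_continuous:
  assumes "C2_unit \<phi>"
  shows "continuous_on {0..1} \<phi>" "continuous_on {0..1} (D1 \<phi>)" "continuous_on {0..1} (L \<phi>)"
  using assms unfolding C2_unit_def C1_unit_def L_def
  by (auto intro: differentiable_imp_continuous_on continuous_on_minus)

lemma Green_identity: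
  fixes u u' \<phi> :: "real \<Rightarrow> complex"
  assumes \<phi>: "C2_unit \<phi>" and ab: "0 \<le> a" "a \<le> b" "b \<le> 1"
    and u: "\<And>z. (u has_vector_derivative u' z) (at z)"
    and u': "\<And>z. (u' has_vector_derivative - (w\<^sup>2 * u z)) (at z)"
  shows "integral {a..b} (\<lambda>z. u z * L \<phi> z) = w\<^sup>2 * integral {a..b} (\<lambda>z. u z * \<phi> z)
    - (u b * D1 \<phi> b - u' b * \<phi> b) + (u a * D1 \<phi> a - u' a * \<phi> a)"
proof -
  let ?W = "\<lambda>z. u z * D1 \<phi> z - u' z * \<phi> z"
  have "(?W has_vector_derivative w\<^sup>2 * (u z * \<phi> z) - u z * L \<phi> z) (at z within {a..b})"
    if z: "z \<in> {a..b}" for z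
  proof -
    have "z \<in> {0..1}" "{a..b} \<subseteq> {0..1}" using z ab by auto
    note d = C2_unit_derivatives[OF \<phi> this(1), THEN has_vector_derivative_within_subset, OF this(2)]
    have "(?W has_vector_derivative u z * - L \<phi> z + u' z * D1 \<phi> z
        - (u' z * D1 \<phi> z + - (w\<^sup>2 * u z) * \<phi> z)) (at z within {a..b})"
      by (intro has_vector_derivative_diff has_vector_derivative_mult d u[THEN has_vector_derivative_at_within]
          u'[THEN has_vector_derivative_at_within])
    then show ?thesis by (simp add: algebra_simps)
  qed
  then have 1: "((\<lambda>z. w\<^sup>2 * (u z * \<phi> z) - u z * L \<phi> z) has_integral ?W b - ?W a) {a..b}"
    using ab by (intro fundamental_theorem_of_calculus) auto
  have "continuous_on {a..b} u"
    by (intro continuous_at_imp_continuous_on ballI has_vector_derivative_continuous[OF u])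
  moreover have "continuous_on {a..b} \<phi>"
    using C2_unit_continuous(1)[OF \<phi>] by (rule continuous_on_subset) (use ab in auto)
  ultimately have "(\<lambda>z. u z * \<phi> z) integrable_on {a..b}"
    by (intro integrable_continuous_interval continuous_intros)
  then have 2: "((\<lambda>z. w\<^sup>2 * (u z * \<phi> z)) has_integral
      w\<^sup>2 * integral {a..b} (\<lambda>z. u z * \<phi> z)) {a..b}"
    by (intro has_integral_mult_right integrable_integral)
  have "((\<lambda>z. u z * L \<phi> z) has_integral
      w\<^sup>2 * integral {a..b} (\<lambda>z. u z * \<phi> z) - (?W b - ?W a)) {a..b}"
    using has_integral_diff[OF 2 1] by simp
  then show ?thesis by (simp add: integral_unique algebra_simps)
qed

lemma Green_exp:
  assumes "C2_unit \<phi>" "0 \<le> y" "y \<le> 1"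
  shows "integral {0..y} (\<lambda>z. exp (- \<i> * w * of_real z) * L \<phi> z) =
    w\<^sup>2 * integral {0..y} (\<lambda>z. exp (- \<i> * w * of_real z) * \<phi> z)
    - exp (- \<i> * w * of_real y) * (D1 \<phi> y + \<i> * w * \<phi> y) + (D1 \<phi> 0 + \<i> * w * \<phi> 0)"
proof -
  have "((\<lambda>z. exp (- \<i> * w * of_real z)) has_vector_derivative
      - \<i> * w * exp (- \<i> * w * of_real z)) (at z)" for z
    by (rule has_vector_derivative_real_field) (auto intro!: derivative_eq_intros)
  moreover have "((\<lambda>z. - \<i> * w * exp (- \<i> * w * of_real z)) has_vector_derivative
      - (w\<^sup>2 * exp (- \<i> * w * of_real z))) (at z)" for z
    by (rule has_vector_derivative_real_field)
      (auto intro!: derivative_eq_intros simp: power2_eq_square algebra_simps)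
  ultimately show ?thesis
    using Green_identity[OF assms(1) order_refl assms(2,3),
        of "\<lambda>z. exp (- \<i> * w * of_real z)" "\<lambda>z. - \<i> * w * exp (- \<i> * w * of_real z)" w]
    by (simp add: algebra_simps)
qed

lemma Green_cos:
  assumes "C2_unit \<phi>" "D1 \<phi> 1 = 0" "0 \<le> y" "y \<le> 1"
  shows "integral {y..1} (\<lambda>z. cos (of_real (1 - z) * w) * L \<phi> z) =
    w\<^sup>2 * integral {y..1} (\<lambda>z. cos (of_real (1 - z) * w) * \<phi> z)
    + cos (of_real (1 - y) * w) * D1 \<phi> y - w * sin (of_real (1 - y) * w) * \<phi> y"
proof -
  have "((\<lambda>z. cos (of_real (1 - z) * w)) has_vector_derivative
      w * sin (of_real (1 - z) * w)) (at z)" for z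
    unfolding of_real_diff of_real_1
    by (rule has_vector_derivative_real_field) (auto intro!: derivative_eq_intros)
  moreover have "((\<lambda>z. w * sin (of_real (1 - z) * w)) has_vector_derivative
      - (w\<^sup>2 * cos (of_real (1 - z) * w))) (at z)" for z
    unfolding of_real_diff of_real_1
    by (rule has_vector_derivative_real_field)
      (auto intro!: derivative_eq_intros simp: power2_eq_square)
  ultimately show ?thesis
    using Green_identity[OF assms(1,3,4) order_refl,
        of "\<lambda>z. cos (of_real (1 - z) * w)" "\<lambda>z. w * sin (of_real (1 - z) * w)" w] assms(2)
    by (simp add: algebra_simps)
qed

lemma Green_sin:
  assumes "C2_unit \<phi>" "D1 \<phi> 1 = 0" "0 \<le> y" "y \<le> 1"
  shows "integral {y..1} (\<lambda>z. sin (of_real (z - y) * w) * L \<phi> z) =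
    w\<^sup>2 * integral {y..1} (\<lambda>z. sin (of_real (z - y) * w) * \<phi> z)
    + w * cos (of_real (1 - y) * w) * \<phi> 1 - w * \<phi> y"
proof -
  have "((\<lambda>z. sin (of_real (z - y) * w)) has_vector_derivative
      w * cos (of_real (z - y) * w)) (at z)" for z
    unfolding of_real_diff
    by (rule has_vector_derivative_real_field) (auto intro!: derivative_eq_intros)
  moreover have "((\<lambda>z. w * cos (of_real (z - y) * w)) has_vector_derivative
      - (w\<^sup>2 * sin (of_real (z - y) * w))) (at z)" for z
    unfolding of_real_diff
    by (rule has_vector_derivative_real_field)
      (auto intro!: derivative_eq_intros simp: power2_eq_square)
  ultimately show ?thesis
    using Green_identity[OF assms(1,3,4) order_refl,
        of "\<lambda>z. sin (of_real (z - y) * w)" "\<lambda>z. w * cos (of_real (z - y) * w)" w] assms(2)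
    by (simp add: algebra_simps)
qed


section \<open>The remainder on the three contours\<close>

text \<open>The boundary terms at the inner endpoint \<open>y\<close> that involve \<open>\<phi>'(y)\<close> cancel between the
  two summands of \<open>\<zeta>\<^sup>+\<close>; those that involve \<open>\<phi>(y)\<close> combine, by
  \<open>i cos \<theta> + sin \<theta> = i e\<^sup>-\<^sup>i\<^sup>\<theta>\<close>, to a factor that does not depend on
  \<open>y\<close>, and so to a multiple of \<open>\<integral> K \<phi> = 0\<close>.\<close>

lemma zeta_plus_L:
  assumes K: "continuous_on {0..1} K" and \<phi>: "\<phi> \<in> Dom_L K"
  shows "zeta_plus K (L \<phi>) w = w\<^sup>2 * zeta_plus K \<phi> w + (D1 \<phi> 0 + \<i> * w * \<phi> 0) * Delta K w"
proof -
  have C2: "C2_unit \<phi>" and orth: "integral {0..1} (\<lambda>y. of_real (K y) * \<phi> y) = 0"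
    and neumann: "D1 \<phi> 1 = 0"
    using \<phi> by (auto simp: Dom_L_def)
  note cont = C2_unit_continuous[OF C2]
  define a where "a = D1 \<phi> 0 + \<i> * w * \<phi> 0"
  define e c where "e = (\<lambda>y::real. exp (- \<i> * w * of_real y))"
    and "c = (\<lambda>y::real. cos (of_real (1 - y) * w))"
  define X where "X = (\<lambda>f y. of_real (K y) * c y * integral {0..y} (\<lambda>z. e z * f z))"
  define Y where "Y = (\<lambda>f y. of_real (K y) * e y * integral {y..1} (\<lambda>z. c z * f z))"
  have zeta: "zeta_plus K f w = integral {0..1} (X f) + integral {0..1} (Y f)" for f
    by (simp add: zeta_plus_def X_def Y_def e_def c_def)
  have ce: "continuous_on {0..1} e" "continuous_on {0..1} c"
    unfolding e_def c_def by (auto intro!: continuous_intros)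
  have XY: "X f integrable_on {0..1}" "Y f integrable_on {0..1}" if "continuous_on {0..1} f" for f
    unfolding X_def Y_def
    by (intro integrable_continuous_interval continuous_intros K ce that
        indefinite_integral_continuous_1 indefinite_integral_continuous_1')+
  have pointwise: "X (L \<phi>) y + Y (L \<phi>) y = w\<^sup>2 * (X \<phi> y + Y \<phi> y) + a * (of_real (K y) * c y)
      - \<i> * w * exp (- \<i> * w) * (of_real (K y) * \<phi> y)" if y: "y \<in> {0..1}" for y
  proof -
    define s where "s = sin (of_real (1 - y) * w)"
    have g1: "integral {0..y} (\<lambda>z. e z * L \<phi> z) = w\<^sup>2 * integral {0..y} (\<lambda>z. e z * \<phi> z)
        - e y * (D1 \<phi> y + \<i> * w * \<phi> y) + a"
      unfolding e_def a_def using y by (intro Green_exp[OF C2]) auto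
    have g2: "integral {y..1} (\<lambda>z. c z * L \<phi> z) = w\<^sup>2 * integral {y..1} (\<lambda>z. c z * \<phi> z)
        + c y * D1 \<phi> y - w * s * \<phi> y"
      unfolding c_def s_def using y by (intro Green_cos[OF C2 neumann]) auto
    have "\<i> * cos \<theta> + sin \<theta> = \<i> * exp (- (\<i> * \<theta>))" for \<theta> :: complex
    proof -
      have "exp (- (\<i> * \<theta>)) = cos \<theta> - \<i> * sin \<theta>"
        using exp_Euler[of "- \<theta>"] by simp
      then show ?thesis by (simp add: right_diff_distrib)
    qed
    then have "\<i> * c y + s = \<i> * exp (- (\<i> * (of_real (1 - y) * w)))"
      by (simp only: c_def s_def)
    then have "e y * (\<i> * c y + s) = \<i> * exp (- \<i> * w)"
      by (simp add: e_def algebra_simps flip: exp_add)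
    then have E: "of_real (K y) * w * \<phi> y * (e y * (\<i> * c y + s))
        = of_real (K y) * w * \<phi> y * (\<i> * exp (- \<i> * w))" by simp
    have "X (L \<phi>) y + Y (L \<phi>) y = w\<^sup>2 * (X \<phi> y + Y \<phi> y) + a * (of_real (K y) * c y)
        - of_real (K y) * w * \<phi> y * (e y * (\<i> * c y + s))"
      unfolding X_def Y_def g1 g2 by (simp add: algebra_simps)
    then show ?thesis unfolding E by (simp add: algebra_simps)
  qed
  have "(\<lambda>y. of_real (K y) * c y) integrable_on {0..1}"
    "(\<lambda>y. of_real (K y) * \<phi> y) integrable_on {0..1}"
    by (intro integrable_continuous_interval continuous_intros K ce cont)+
  then have "((\<lambda>y. w\<^sup>2 * (X \<phi> y + Y \<phi> y) + a * (of_real (K y) * c y)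
      - \<i> * w * exp (- \<i> * w) * (of_real (K y) * \<phi> y)) has_integral
      w\<^sup>2 * (integral {0..1} (X \<phi>) + integral {0..1} (Y \<phi>))
      + a * integral {0..1} (\<lambda>y. of_real (K y) * c y)
      - \<i> * w * exp (- \<i> * w) * integral {0..1} (\<lambda>y. of_real (K y) * \<phi> y)) {0..1}"
    by (intro has_integral_add has_integral_diff has_integral_mult_right integrable_integral
        XY cont)
  then have "((\<lambda>y. X (L \<phi>) y + Y (L \<phi>) y) has_integral
      w\<^sup>2 * zeta_plus K \<phi> w + a * Delta K w) {0..1}"
    unfolding orth zeta by (subst has_integral_cong[OF pointwise]) (simp_all add: Delta_def c_def)
  then have "integral {0..1} (\<lambda>y. X (L \<phi>) y + Y (L \<phi>) y) = w\<^sup>2 * zeta_plus K \<phi> w + a * Delta K w"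
    by (rule integral_unique)
  moreover have "integral {0..1} (\<lambda>y. X (L \<phi>) y + Y (L \<phi>) y) = zeta_plus K (L \<phi>) w"
    unfolding zeta using XY[OF cont(3)] by (intro integral_add)
  ultimately show ?thesis by (simp add: a_def)
qed

text \<open>Green's identity with \<open>sin ((z - y) w)\<close>, which vanishes at \<open>z = y\<close>, leaves only
  \<open>\<phi>(1)\<close> with the factor \<open>cos ((1 - y) w)\<close> that makes up \<open>\<Delta>\<close>, and a term
  \<open>\<phi>(y)\<close> that integrates to zero against \<open>K\<close>.\<close>

lemma zeta_minus_L:
  assumes K: "continuous_on {0..1} K" and \<phi>: "\<phi> \<in> Dom_L K"
  shows "zeta_minus K (L \<phi>) w = w\<^sup>2 * zeta_minus K \<phi> w + \<i> * w * \<phi> 1 * Delta K w"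
proof -
  have C2: "C2_unit \<phi>" and orth: "integral {0..1} (\<lambda>y. of_real (K y) * \<phi> y) = 0"
    and neumann: "D1 \<phi> 1 = 0"
    using \<phi> by (auto simp: Dom_L_def)
  note cont = C2_unit_continuous[OF C2]
  define c where "c = (\<lambda>y::real. cos (of_real (1 - y) * w))"
  define Y where "Y = (\<lambda>f y. of_real (K y) * integral {y..1} (\<lambda>z. sin (of_real (z - y) * w) * f z))"
  have zeta: "zeta_minus K f w = \<i> * integral {0..1} (Y f)" for f
    by (simp add: zeta_minus_def Y_def)
  have Y: "Y \<phi> integrable_on {0..1}"
  proof -
    \<comment> \<open>the parameter \<open>y\<close> also occurs in the integrand; the addition theorem separates it\<close>
    have "integral {y..1} (\<lambda>z. sin (of_real (z - y) * w) * \<phi> z) =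
        cos (of_real y * w) * integral {y..1} (\<lambda>z. sin (of_real z * w) * \<phi> z)
        - sin (of_real y * w) * integral {y..1} (\<lambda>z. cos (of_real z * w) * \<phi> z)"
      if "y \<in> {0..1}" for y
    proof -
      have "continuous_on {y..1} \<phi>"
        using cont(1) by (rule continuous_on_subset) (use that in auto)
      then have "((\<lambda>z. cos (of_real y * w) * (sin (of_real z * w) * \<phi> z)
          - sin (of_real y * w) * (cos (of_real z * w) * \<phi> z)) has_integral
          cos (of_real y * w) * integral {y..1} (\<lambda>z. sin (of_real z * w) * \<phi> z)
        - sin (of_real y * w) * integral {y..1} (\<lambda>z. cos (of_real z * w) * \<phi> z)) {y..1}"
        by (intro has_integral_diff has_integral_mult_right integrable_integral
            integrable_continuous_interval continuous_intros)
      moreover have "(\<lambda>z. cos (of_real y * w) * (sin (of_real z * w) * \<phi> z)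
          - sin (of_real y * w) * (cos (of_real z * w) * \<phi> z))
          = (\<lambda>z. sin (of_real (z - y) * w) * \<phi> z)"
        by (auto simp: sin_diff left_diff_distrib algebra_simps)
      ultimately show ?thesis by (simp add: integral_unique)
    qed
    moreover have "continuous_on {0..1} (\<lambda>y. of_real (K y) *
        (cos (of_real y * w) * integral {y..1} (\<lambda>z. sin (of_real z * w) * \<phi> z)
        - sin (of_real y * w) * integral {y..1} (\<lambda>z. cos (of_real z * w) * \<phi> z)))"
      by (intro continuous_intros K indefinite_integral_continuous_1'
          integrable_continuous_interval cont)
    ultimately have "continuous_on {0..1} (Y \<phi>)"
      unfolding Y_def by (subst continuous_on_cong[OF refl]) (auto simp: mult.assoc)
    then show ?thesis by (rule integrable_continuous_interval)
  qed
  have pointwise: "Y (L \<phi>) y = w\<^sup>2 * Y \<phi> y + w * \<phi> 1 * (of_real (K y) * c y)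
      - w * (of_real (K y) * \<phi> y)" if y: "y \<in> {0..1}" for y
    unfolding Y_def c_def using y
    by (subst Green_sin[OF C2 neumann]) (auto simp: algebra_simps)
  have "continuous_on {0..1} c" unfolding c_def by (intro continuous_intros)
  then have "(\<lambda>y. of_real (K y) * c y) integrable_on {0..1}"
    "(\<lambda>y. of_real (K y) * \<phi> y) integrable_on {0..1}"
    by (auto intro!: integrable_continuous_interval continuous_intros K cont)
  then have "((\<lambda>y. w\<^sup>2 * Y \<phi> y + w * \<phi> 1 * (of_real (K y) * c y)
      - w * (of_real (K y) * \<phi> y)) has_integral
      w\<^sup>2 * integral {0..1} (Y \<phi>) + w * \<phi> 1 * integral {0..1} (\<lambda>y. of_real (K y) * c y)
      - w * integral {0..1} (\<lambda>y. of_real (K y) * \<phi> y)) {0..1}"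
    by (intro has_integral_add has_integral_diff has_integral_mult_right integrable_integral Y)
  then have "(Y (L \<phi>) has_integral
      w\<^sup>2 * integral {0..1} (Y \<phi>) + w * \<phi> 1 * Delta K w) {0..1}"
    unfolding orth by (subst has_integral_cong[OF pointwise]) (simp_all add: Delta_def c_def)
  then show ?thesis by (simp add: zeta integral_unique algebra_simps)
qed

lemma remainder_real:
  assumes "\<phi> \<in> Dom_L K" "w \<in> \<real>"
  shows "F K \<rho> (L \<phi>) w - w\<^sup>2 * F K \<rho> \<phi> w =
    D1 \<phi> 0 + \<i> * w * \<phi> 0 - \<i> * w * exp (- \<i> * w) * \<phi> 1"
  using assms Green_exp[of \<phi> 1 w] by (auto simp: F_def Dom_L_def)

lemma frontier_D_minus: "w \<in> frontier (D_minus \<rho>) \<longleftrightarrow> - w \<in> frontier (D_plus \<rho>)"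
proof -
  have "frontier (D_minus \<rho>) = uminus ` frontier (D_plus \<rho>)"
    using closure_injective_linear_image[of uminus "D_plus \<rho>"]
      interior_injective_linear_image[of uminus "D_plus \<rho>"]
    by (auto simp: D_minus_eq frontier_def linear_uminus image_set_diff)
  then show ?thesis by (force simp: image_iff)
qed

lemma Im_frontier_D_plus:
  assumes "\<rho> > 0" "w \<in> frontier (D_plus \<rho>)"
  shows "\<rho> / sqrt 2 \<le> Im w"
proof -
  have w: "\<bar>Re w\<bar> \<le> Im w" "\<rho> \<le> norm w" using assms by (auto simp: frontier_D_plus)
  have "\<rho>\<^sup>2 \<le> (norm w)\<^sup>2" using w assms(1) by (intro power_mono) auto
  also have "\<dots> \<le> 2 * (Im w)\<^sup>2"
    using power_mono[OF w(1), of 2] by (simp add: cmod_power2)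
  finally have "(\<rho> / sqrt 2)\<^sup>2 \<le> (Im w)\<^sup>2" by (simp add: power_divide)
  then show ?thesis by (rule power2_le_imp_le) (use w in linarith)
qed

lemma remainder_plus:
  assumes K: "continuous_on {0..1} K" and \<rho>: "\<rho> > 0"
    and zeros: "\<And>w. Delta K w = 0 \<Longrightarrow> \<bar>Im w\<bar> < \<rho> / sqrt 2"
    and \<phi>: "\<phi> \<in> Dom_L K" and w: "w \<in> frontier (D_plus \<rho>)"
  shows "F K \<rho> (L \<phi>) w - w\<^sup>2 * F K \<rho> \<phi> w = - (D1 \<phi> 0 + \<i> * w * \<phi> 0)"
proof -
  have Im: "\<rho> / sqrt 2 \<le> Im w" "0 < \<rho> / sqrt 2"
    using Im_frontier_D_plus[OF \<rho> w] \<rho> by auto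
  then have nz: "Delta K w \<noteq> 0" using zeros[of w] by force
  have "w \<notin> \<real>" using Im complex_is_Real_iff by force
  then show ?thesis using w nz
    by (simp add: F_def zeta_plus_L[OF K \<phi>] field_simps)
qed

lemma remainder_minus:
  assumes K: "continuous_on {0..1} K" and \<rho>: "\<rho> > 0"
    and zeros: "\<And>w. Delta K w = 0 \<Longrightarrow> \<bar>Im w\<bar> < \<rho> / sqrt 2"
    and \<phi>: "\<phi> \<in> Dom_L K" and w: "w \<in> frontier (D_minus \<rho>)"
  shows "F K \<rho> (L \<phi>) w - w\<^sup>2 * F K \<rho> \<phi> w = - \<i> * w * exp (- \<i> * w) * \<phi> 1"
proof -
  have Im: "Im w \<le> - (\<rho> / sqrt 2)" "0 < \<rho> / sqrt 2"
    using Im_frontier_D_plus[OF \<rho>, of "- w"] w \<rho> by (auto simp: frontier_D_minus)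
  then have nz: "Delta K w \<noteq> 0" using zeros[of w] by force
  have "w \<notin> \<real>" using Im complex_is_Real_iff by force
  moreover have "w \<notin> frontier (D_plus \<rho>)" using Im_frontier_D_plus[OF \<rho>, of w] Im by auto
  ultimately show ?thesis using w nz
    by (simp add: F_def zeta_minus_L[OF K \<phi>] field_simps)
qed


section \<open>The time integral\<close>

definition duhamel :: "real \<Rightarrow> (real \<Rightarrow> complex) \<Rightarrow> complex \<Rightarrow> complex" where
  "duhamel t g w = integral {0..t} (\<lambda>s. exp (w\<^sup>2 * of_real (s - t)) * g s)"

lemma duhamel_even: "duhamel t g (- w) = duhamel t g w"
  by (simp add: duhamel_def)

lemma duhamel_integrable:
  fixes g :: "real \<Rightarrow> complex"
  assumes "continuous_on {0..t} g"
  shows "(\<lambda>s. exp (w\<^sup>2 * of_real (s - t)) * g s) integrable_on {0..t}"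
  by (intro integrable_continuous_interval continuous_intros assms)

lemma duhamel_add:
  assumes "continuous_on {0..t} g" "continuous_on {0..t} h"
  shows "duhamel t (\<lambda>s. g s + h s) w = duhamel t g w + duhamel t h w"
  unfolding duhamel_def distrib_left by (intro integral_add duhamel_integrable assms)

lemma duhamel_mult: "duhamel t (\<lambda>s. c * g s) w = c * duhamel t g w"
  unfolding duhamel_def by (simp add: mult.left_commute[of _ c])

lemma duhamel_holomorphic:
  assumes g: "continuous_on {0..t} g"
  shows "duhamel t g holomorphic_on UNIV"
proof -
  have "(\<lambda>w. integral (cbox 0 t) (\<lambda>s. exp (w\<^sup>2 * of_real (s - t)) * g s)) holomorphic_on UNIV"
  proof (rule leibniz_rule_holomorphic)
    show "((\<lambda>w. exp (w\<^sup>2 * of_real (s - t)) * g s) has_field_derivative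
        2 * w * of_real (s - t) * exp (w\<^sup>2 * of_real (s - t)) * g s) (at w within UNIV)" for w s
      by (auto intro!: derivative_eq_intros)
    have "continuous_on (UNIV \<times> {0..t}) (\<lambda>p. g (snd p))"
      by (rule continuous_on_compose2[OF g]) (auto intro!: continuous_intros)
    then show "continuous_on (UNIV \<times> cbox 0 t)
        (\<lambda>(w::complex, s). 2 * w * of_real (s - t) * exp (w\<^sup>2 * of_real (s - t)) * g s)"
      unfolding case_prod_beta by (auto intro!: continuous_intros)
  qed (use duhamel_integrable[OF g] in auto)
  then show ?thesis by (simp add: duhamel_def[abs_def])
qed

text \<open>Where \<open>Re (w\<^sup>2) \<ge> 0\<close> the exponential is bounded by \<open>1\<close>, so an integration by parts
  trades \<open>w\<^sup>2\<close> for a derivative of \<open>g\<close>.\<close>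

lemma duhamel_decay:
  assumes t: "0 \<le> t"
    and g: "\<And>s. s \<in> {0..t} \<Longrightarrow> (g has_vector_derivative g' s) (at s within {0..t})"
    and g': "continuous_on {0..t} g'"
  obtains C where "\<And>w. 0 \<le> Re (w\<^sup>2) \<Longrightarrow> norm (w\<^sup>2 * duhamel t g w) \<le> C"
proof -
  have gc: "continuous_on {0..t} g"
    using g by (rule continuous_on_vector_derivative)
  obtain M where M: "\<And>s. s \<in> {0..t} \<Longrightarrow> norm (g' s) \<le> M" "M \<ge> 0"
  proof -
    have "bounded (g' ` {0..t})" by (intro compact_imp_bounded compact_continuous_image g') simp
    then show ?thesis using that by (force simp: bounded_pos)
  qed
  have "norm (w\<^sup>2 * duhamel t g w) \<le> norm (g t) + norm (g 0) + M * t" if w: "0 \<le> Re (w\<^sup>2)" for w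
  proof -
    define E where "E = (\<lambda>s. exp (w\<^sup>2 * of_real (s - t)))"
    have E: "norm (E s) \<le> 1" if "s \<in> {0..t}" for s
      using that w by (auto simp: E_def mult_nonneg_nonpos)
    have Ec: "continuous_on {0..t} E" unfolding E_def by (intro continuous_intros)
    have dE: "(E has_vector_derivative w\<^sup>2 * E s) (at s within {0..t})" for s
      unfolding E_def of_real_diff
      by (rule has_vector_derivative_real_field) (auto intro!: derivative_eq_intros)
    have "((\<lambda>s. E s * g s) has_vector_derivative E s * g' s + w\<^sup>2 * (E s * g s))
        (at s within {0..t})" if "s \<in> {0..t}" for s
      using has_vector_derivative_mult[OF dE g[OF that]] by (simp add: algebra_simps)
    then have "((\<lambda>s. E s * g' s + w\<^sup>2 * (E s * g s)) has_integral E t * g t - E 0 * g 0) {0..t}"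
      using t by (intro fundamental_theorem_of_calculus) auto
    moreover have i: "(\<lambda>s. E s * g' s) integrable_on {0..t}"
      by (intro integrable_continuous_interval continuous_intros Ec g')
    ultimately have "((\<lambda>s. w\<^sup>2 * (E s * g s)) has_integral
        (E t * g t - E 0 * g 0) - integral {0..t} (\<lambda>s. E s * g' s)) {0..t}"
      using has_integral_diff[OF _ integrable_integral[OF i]] by fastforce
    moreover have "((\<lambda>s. w\<^sup>2 * (E s * g s)) has_integral w\<^sup>2 * duhamel t g w) {0..t}"
      using has_integral_mult_right[OF integrable_integral[OF duhamel_integrable[OF gc, of w]]]
      by (simp add: duhamel_def E_def)
    ultimately have eq: "w\<^sup>2 * duhamel t g w =
        (E t * g t - E 0 * g 0) - integral {0..t} (\<lambda>s. E s * g' s)"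
      by (metis has_integral_unique)
    have "norm (integral {0..t} (\<lambda>s. E s * g' s)) \<le> M * (t - 0)"
    proof (intro integral_bound t ballI)
      show "norm (E s * g' s) \<le> M" if "s \<in> {0..t}" for s
        using mult_mono[OF E[OF that] M(1)[OF that]] by (simp add: norm_mult)
    qed (intro continuous_intros Ec g')
    moreover have "norm (E t * g t) \<le> norm (g t)" "norm (E 0 * g 0) \<le> norm (g 0)"
      using E[of t] E[of 0] t by (auto simp: norm_mult intro!: mult_left_le_one_le)
    ultimately show ?thesis
      unfolding eq
      using norm_triangle_ineq4[of "E t * g t - E 0 * g 0" "integral {0..t} (\<lambda>s. E s * g' s)"]
        norm_triangle_ineq4[of "E t * g t" "E 0 * g 0"] by simp
  qed
  then show ?thesis by (rule that)
qed


section \<open>Deformation of the real line to the upper contour\<close>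

text \<open>The mean value inequality with the comparison function \<open>- M / a * exp (- a * r)\<close> gives
  the estimate that an integral of \<open>h'\<close> would give, directly for the increments of \<open>h\<close>.\<close>

lemma exp_decay_increment:
  fixes h :: "real \<Rightarrow> complex"
  assumes a: "a > 0" and uv: "u \<le> v"
    and h: "\<And>r. u \<le> r \<Longrightarrow> r \<le> v \<Longrightarrow> (h has_vector_derivative h' r) (at r)"
    and bound: "\<And>r. u \<le> r \<Longrightarrow> r \<le> v \<Longrightarrow> norm (h' r) \<le> M * exp (- a * r)"
  shows "norm (h v - h u) \<le> M / a * (exp (- a * u) - exp (- a * v))"
proof (cases "u = v")
  case False
  have "norm (h v - h u) \<le> - M / a * exp (- a * v) - (- M / a * exp (- a * u))"
  proof (rule differentiable_bound_general)
    show "u < v" using False uv by simp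
    show "continuous_on {u..v} h"
      by (intro continuous_at_imp_continuous_on ballI has_vector_derivative_continuous[OF h]) auto
    show "continuous_on {u..v} (\<lambda>r. - M / a * exp (- a * r))" by (intro continuous_intros)
    show "((\<lambda>r. - M / a * exp (- a * r)) has_vector_derivative M * exp (- a * r)) (at r)" for r
      unfolding has_real_derivative_iff_has_vector_derivative[symmetric] using a
      by (auto intro!: derivative_eq_intros)
    show "norm (h' r) \<le> M * exp (- a * r)" if "u < r" "r < v" for r using that bound by simp
    show "(h has_vector_derivative h' r) (at r)" if "u < r" "r < v" for r using that h by simp
  qed
  then show ?thesis by (simp add: algebra_simps)
qed simp

lemma exp_decay_converges:
  fixes h :: "real \<Rightarrow> complex"
  assumes a: "a > 0"
    and h: "\<And>r. u \<le> r \<Longrightarrow> (h has_vector_derivative h' r) (at r)"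
    and bound: "\<And>r. u \<le> r \<Longrightarrow> norm (h' r) \<le> M * exp (- a * r)"
  shows "\<exists>l. (h \<longlongrightarrow> l) at_top"
proof -
  have "0 \<le> M * exp (- a * u)" using bound[of u] norm_ge_zero order_trans by blast
  then have M: "0 \<le> M" by (simp add: zero_le_mult_iff)
  have incr: "norm (h q - h p) \<le> M / a * exp (- a * p)" if "u \<le> p" "p \<le> q" for p q
  proof -
    have "norm (h q - h p) \<le> M / a * (exp (- a * p) - exp (- a * q))"
      using that by (intro exp_decay_increment[OF a that(2) h bound]) auto
    also have "\<dots> \<le> M / a * exp (- a * p)" using a M by (intro mult_left_mono) auto
    finally show ?thesis .
  qed
  have lim0: "((\<lambda>p. M / a * exp (- a * p)) \<longlongrightarrow> 0) at_top"
    using a by real_asymp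
  have "Cauchy (\<lambda>n. h (real n))"
  proof (rule metric_CauchyI)
    fix e :: real assume "e > 0"
    then have "\<forall>\<^sub>F p in at_top. M / a * exp (- a * p) < e / 2 \<and> u \<le> p"
      using order_tendstoD(2)[OF lim0, of "e / 2"] eventually_ge_at_top[of u]
      by (intro eventually_conj) auto
    then obtain p0 where p0: "\<And>p. p0 \<le> p \<Longrightarrow> M / a * exp (- a * p) < e / 2 \<and> u \<le> p"
      by (auto simp: eventually_at_top_linorder)
    obtain k where k: "p0 \<le> real k" using real_arch_simple by blast
    have d: "dist (h (real m)) (h (real k)) < e / 2" if "m \<ge> k" for m
      using incr[of "real k" "real m"] p0[OF k] that unfolding dist_norm
      by (meson le_less_trans of_nat_mono)
    have "dist (h (real m)) (h (real n)) < e" if "m \<ge> k" "n \<ge> k" for m n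
      using d[OF that(1)] d[OF that(2)] dist_triangle_half_l by blast
    then show "\<exists>k. \<forall>m\<ge>k. \<forall>n\<ge>k. dist (h (real m)) (h (real n)) < e" by blast
  qed
  then obtain l where l: "(\<lambda>n. h (real n)) \<longlonglongrightarrow> l"
    using Cauchy_convergent convergent_def by blast
  have "norm (h p - l) \<le> M / a * exp (- a * p)" if p: "u \<le> p" for p
  proof (rule tendsto_upperbound)
    show "(\<lambda>n. norm (h p - h (real n))) \<longlonglongrightarrow> norm (h p - l)"
      by (intro tendsto_intros l)
    show "\<forall>\<^sub>F n in sequentially. norm (h p - h (real n)) \<le> M / a * exp (- a * p)"
      using eventually_ge_at_top[of "nat \<lceil>p\<rceil>"]
    proof eventually_elim
      case (elim n)
      then have "p \<le> real n" by linarith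
      then show ?case using incr[OF p, of "real n"] by (simp only: norm_minus_commute)
    qed
  qed simp
  then have "((\<lambda>p. h p - l) \<longlongrightarrow> 0) at_top"
    by (intro Lim_null_comparison[OF _ lim0]) (auto simp: eventually_at_top_linorder)
  then show ?thesis using Lim_null by blast
qed

lemma valid_path_plus_path: "valid_path (plus_path \<rho> N)"
proof -
  have "pathfinish (part_circlepath 0 \<rho> (3 * pi / 4) (pi / 4)) = of_real \<rho> * cis (pi / 4)"
    "pathstart (part_circlepath 0 \<rho> (3 * pi / 4) (pi / 4)) = of_real \<rho> * cis (3 * pi / 4)"
    by (simp_all add: cis_conv_exp)
  then show ?thesis unfolding plus_path_def
    by (auto intro!: valid_path_join
        simp del: pathstart_part_circlepath pathfinish_part_circlepath)
qed

text \<open>Everything is expressed by one entire primitive \<open>\<Phi>\<close> of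
  \<open>e\<^sup>i\<^sup>w\<^sup>x P(w)\<close>. The integral over the upper contour converges because \<open>\<Phi>\<close>
  has limits along the two rays, on which the integrand decays exponentially. It differs from the
  integral over the real line by increments of \<open>\<Phi>\<close> from \<open>\<plusminus> N\<close> to the ends of the rays. On
  the chord between these points the integrand is \<open>O(1/N)\<close> times an exponential that decays,
  at a rate independent of \<open>N\<close>, in the distance from \<open>\<plusminus> N\<close>. Hence the increment is
  \<open>O(1/N)\<close>: this is Jordan's lemma with chords in place of arcs.\<close>

lemma improper_integrals_agree:
  fixes P :: "complex \<Rightarrow> complex"
  assumes P: "P holomorphic_on UNIV" and \<rho>: "\<rho> > 0" and x: "x > 0"
    and bound: "\<And>w. 0 \<le> Re (w\<^sup>2) \<Longrightarrow> \<rho> \<le> norm w \<Longrightarrow> norm (w * P w) \<le> C"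
  obtains I where
    "has_improper_integral (\<lambda>w. exp (\<i> * w * of_real x) * P w) I real_path"
    "has_improper_integral (\<lambda>w. exp (\<i> * w * of_real x) * P w) I (plus_path \<rho>)"
proof -
  define f where "f = (\<lambda>w. exp (\<i> * w * of_real x) * P w)"
  have "f holomorphic_on UNIV" unfolding f_def by (intro holomorphic_intros P)
  then obtain \<Phi> where \<Phi>: "\<And>w. (\<Phi> has_field_derivative f w) (at w)"
    using holomorphic_convex_primitive'[of UNIV f] by auto
  have f: "norm (f w) \<le> exp (- x * Im w) * (C / norm w)"
    if "0 \<le> Re (w\<^sup>2)" "\<rho> \<le> norm w" for w
  proof -
    have "norm (P w) \<le> C / norm w"
      using bound[OF that] order_less_le_trans[OF \<rho> that(2)]
      by (simp add: norm_mult pos_le_divide_eq mult.commute)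
    then have "exp (- x * Im w) * norm (P w) \<le> exp (- x * Im w) * (C / norm w)"
      by (rule mult_left_mono) simp
    then show ?thesis by (simp add: f_def norm_mult mult.commute)
  qed
  have C: "0 \<le> C"
    by (rule order_trans[OF norm_ge_zero bound[of "of_real \<rho>"]])
      (use \<rho> in \<open>simp_all flip: of_real_power\<close>)
  have deriv_\<Phi>: "((\<lambda>r. \<Phi> (\<gamma> r)) has_vector_derivative d * f (\<gamma> r)) (at r)"
    if "(\<gamma> has_vector_derivative d) (at r)" for \<gamma> d r
    using field_vector_diff_chain_at[OF that \<Phi>] by (simp add: o_def)

  have ray: "\<exists>l. ((\<lambda>r. \<Phi> (of_real r * c)) \<longlongrightarrow> l) at_top"
    if c: "Im c = sqrt 2 / 2" "norm c = 1" for c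
  proof (rule exp_decay_converges)
    show "0 < x * (sqrt 2 / 2)" using x by simp
    show "((\<lambda>r. \<Phi> (of_real r * c)) has_vector_derivative c * f (of_real r * c)) (at r)" for r
      by (rule deriv_\<Phi>, rule has_vector_derivative_real_field) (auto intro!: derivative_eq_intros)
    show "norm (c * f (of_real r * c)) \<le> C / \<rho> * exp (- (x * (sqrt 2 / 2)) * r)" if r: "\<rho> \<le> r" for r
    proof -
      have "(Im c)\<^sup>2 = 1 / 2" by (simp add: c power_divide)
      then have "(Re c)\<^sup>2 = (Im c)\<^sup>2" using cmod_power2[of c] c(2) by simp
      then have "Re ((of_real r * c)\<^sup>2) = 0"
        by (simp add: power2_eq_square algebra_simps)
      then have "norm (f (of_real r * c)) \<le> exp (- x * Im (of_real r * c)) * (C / r)"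
        using f[of "of_real r * c"] r \<rho> c(2) by (simp add: norm_mult)
      also have "\<dots> \<le> exp (- x * Im (of_real r * c)) * (C / \<rho>)"
        using r \<rho> C by (intro mult_left_mono divide_left_mono) auto
      finally show ?thesis using c by (simp add: norm_mult mult_ac)
    qed
  qed

  have chord: "((\<lambda>N. \<Phi> (of_real N * c) - \<Phi> (of_real N * of_real \<epsilon>)) \<longlongrightarrow> 0) at_top"
    if c: "Im c = sqrt 2 / 2" "Re c = \<epsilon> * (sqrt 2 / 2)" and \<epsilon>: "\<bar>\<epsilon>\<bar> = 1" for c \<epsilon>
  proof -
    have cn: "norm c = 1"
    proof -
      have "\<epsilon>\<^sup>2 = 1" using \<epsilon> by (metis power2_abs one_power2)
      then show ?thesis by (simp add: cmod_def c power_mult_distrib power_divide)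
    qed
    have est: "norm (\<Phi> (of_real N * c) - \<Phi> (of_real N * of_real \<epsilon>)) \<le> 4 * C / (N * x * (sqrt 2 / 2))"
      if N: "2 * \<rho> \<le> N" for N
    proof -
      have N0: "N > 0" using N \<rho> by linarith
      define \<gamma> where "\<gamma> = (\<lambda>r. of_real N * ((1 - of_real r) * of_real \<epsilon> + of_real r * c))"
      define d where "d = of_real N * (c - of_real \<epsilon>)"
      have dn: "norm d \<le> 2 * N"
        using norm_triangle_ineq4[of c "of_real \<epsilon>"] cn \<epsilon> N0 by (simp add: d_def norm_mult)
      \<comment> \<open>\<open>4 C\<close> is the length bound \<open>2 N\<close> of the chord times the bound \<open>C / (N / 2)\<close> for
        \<open>P\<close>, as the chord stays at distance at least \<open>N / 2\<close> from the origin\<close>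
      have "norm (\<Phi> (\<gamma> 1) - \<Phi> (\<gamma> 0)) \<le> 4 * C / (N * x * (sqrt 2 / 2)) *
          (exp (- (N * x * (sqrt 2 / 2)) * 0) - exp (- (N * x * (sqrt 2 / 2)) * 1))"
      proof (rule exp_decay_increment)
        show "0 < N * x * (sqrt 2 / 2)" using N0 x by simp
        show "((\<lambda>r. \<Phi> (\<gamma> r)) has_vector_derivative d * f (\<gamma> r)) (at r)" for r
          unfolding \<gamma>_def d_def
          by (rule deriv_\<Phi>, rule has_vector_derivative_real_field)
            (auto intro!: derivative_eq_intros simp: algebra_simps)
        show "norm (d * f (\<gamma> r)) \<le> 4 * C * exp (- (N * x * (sqrt 2 / 2)) * r)"
          if r: "0 \<le> r" "r \<le> 1" for r
        proof -
          define \<tau> where "\<tau> = 1 - r + r * (sqrt 2 / 2)"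
          have Im: "Im (\<gamma> r) = N * (r * (sqrt 2 / 2))" by (simp add: \<gamma>_def c)
          have "Re (\<gamma> r) = \<epsilon> * (N * \<tau>)" by (simp add: \<gamma>_def c \<tau>_def algebra_simps)
          moreover have s: "1 / 2 \<le> sqrt 2 / 2" by simp
          have "r * (1 / 2) \<le> r * (sqrt 2 / 2)" by (rule mult_left_mono[OF s r(1)])
          then have \<tau>: "1 / 2 \<le> \<tau>" "r * (sqrt 2 / 2) \<le> \<tau>" using r by (auto simp: \<tau>_def)
          ultimately have Re: "\<bar>Re (\<gamma> r)\<bar> = N * \<tau>" using N0 \<epsilon> by (simp add: abs_mult)
          have "\<bar>Im (\<gamma> r)\<bar> \<le> \<bar>Re (\<gamma> r)\<bar>" using \<tau> r N0 by (simp add: Re Im abs_mult)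
          then have sq: "0 \<le> Re ((\<gamma> r)\<^sup>2)"
            using abs_le_square_iff[of "Im (\<gamma> r)" "Re (\<gamma> r)"] by (simp add: power2_eq_square)
          have "N * (1 / 2) \<le> N * \<tau>" using \<tau> N0 by (intro mult_left_mono) auto
          then have n: "N / 2 \<le> norm (\<gamma> r)"
            using abs_Re_le_cmod[of "\<gamma> r"] Re by linarith
          then have "\<rho> \<le> norm (\<gamma> r)" using N by linarith
          then have "norm (f (\<gamma> r)) \<le> exp (- x * Im (\<gamma> r)) * (C / norm (\<gamma> r))"
            by (rule f[OF sq])
          also have "\<dots> \<le> exp (- x * Im (\<gamma> r)) * (C / (N / 2))"
            using n N0 C by (intro mult_left_mono divide_left_mono mult_pos_pos) auto
          finally have "norm d * norm (f (\<gamma> r)) \<le> (2 * N) * (exp (- x * Im (\<gamma> r)) * (C / (N / 2)))"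
            using dn N0 by (intro mult_mono) auto
          also have "\<dots> = 4 * C * exp (- (N * x * (sqrt 2 / 2)) * r)"
            using N0 by (simp add: Im field_simps)
          finally show ?thesis by (simp add: norm_mult)
        qed
      qed simp
      also have "\<dots> \<le> 4 * C / (N * x * (sqrt 2 / 2)) * 1"
        using C N0 x by (intro mult_left_mono) auto
      finally show ?thesis by (simp add: \<gamma>_def)
    qed
    have "((\<lambda>N. 4 * C / (N * x * (sqrt 2 / 2))) \<longlongrightarrow> 0) at_top" using x by real_asymp
    then show ?thesis
      by (rule Lim_null_comparison[rotated])
        (use est in \<open>auto simp: eventually_at_top_linorder intro!: exI[of _ "2 * \<rho>"]\<close>)
  qed

  let ?p = "cis (pi / 4)" and ?m = "cis (3 * pi / 4)"
  obtain lp lm where lp: "((\<lambda>r. \<Phi> (of_real r * ?p)) \<longlongrightarrow> lp) at_top"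
    and lm: "((\<lambda>r. \<Phi> (of_real r * ?m)) \<longlongrightarrow> lm) at_top"
    using ray[of ?p] ray[of ?m] cis_vals by (metis norm_cis)
  have plus: "(f has_contour_integral \<Phi> (of_real N * ?p) - \<Phi> (of_real N * ?m)) (plus_path \<rho> N)" for N
    using contour_integral_primitive[of UNIV \<Phi> f, OF _ valid_path_plus_path[of \<rho> N]] \<Phi>
    by (simp add: plus_path_def)
  have real: "(f has_contour_integral \<Phi> (of_real N) - \<Phi> (- of_real N)) (real_path N)" for N
    using contour_integral_primitive[of UNIV \<Phi> f "real_path N"] \<Phi> by (simp add: real_path_def)
  have plus_lim: "((\<lambda>N. \<Phi> (of_real N * ?p) - \<Phi> (of_real N * ?m)) \<longlongrightarrow> lp - lm) at_top"
    by (intro tendsto_intros lp lm)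
  have "((\<lambda>N. \<Phi> (of_real N) - \<Phi> (- of_real N)) \<longlongrightarrow> lp - lm) at_top"
    using tendsto_add[OF plus_lim tendsto_diff[OF chord[of ?m "-1"] chord[of ?p 1]]] cis_vals
    by simp
  then have "has_improper_integral f (lp - lm) real_path"
    unfolding has_improper_integral_def using real by (intro exI conjI) auto
  moreover have "has_improper_integral f (lp - lm) (plus_path \<rho>)"
    unfolding has_improper_integral_def using plus plus_lim by (intro exI conjI) auto
  ultimately show ?thesis using that by (simp add: f_def)
qed


section \<open>Rules for improper contour integrals\<close>

lemma has_improper_integral_add:
  assumes "has_improper_integral f I \<gamma>" "has_improper_integral g J \<gamma>"
  shows "has_improper_integral (\<lambda>w. f w + g w) (I + J) \<gamma>"
proof -
  obtain I' J' where
    "\<forall>\<^sub>F N in at_top. (f has_contour_integral I' N) (\<gamma> N)" "(I' \<longlongrightarrow> I) at_top"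
    "\<forall>\<^sub>F N in at_top. (g has_contour_integral J' N) (\<gamma> N)" "(J' \<longlongrightarrow> J) at_top"
    using assms by (auto simp: has_improper_integral_def)
  moreover from this(1,3) have "\<forall>\<^sub>F N in at_top.
      ((\<lambda>w. f w + g w) has_contour_integral I' N + J' N) (\<gamma> N)"
    by eventually_elim (rule has_contour_integral_add)
  ultimately show ?thesis unfolding has_improper_integral_def
    by (intro exI[of _ "\<lambda>N. I' N + J' N"] conjI tendsto_add)
qed

lemma has_improper_integral_neg:
  assumes "has_improper_integral f I \<gamma>"
  shows "has_improper_integral (\<lambda>w. - f w) (- I) \<gamma>"
proof -
  obtain I' where
    "\<forall>\<^sub>F N in at_top. (f has_contour_integral I' N) (\<gamma> N)" "(I' \<longlongrightarrow> I) at_top"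
    using assms by (auto simp: has_improper_integral_def)
  then show ?thesis unfolding has_improper_integral_def
    by (intro exI[of _ "\<lambda>N. - I' N"] conjI tendsto_minus)
      (auto elim!: eventually_mono intro: has_contour_integral_neg)
qed

lemma has_improper_integral_cong:
  assumes "has_improper_integral f I \<gamma>"
    and "\<forall>\<^sub>F N in at_top. path_image (\<gamma> N) \<subseteq> S" "\<And>w. w \<in> S \<Longrightarrow> f w = g w"
  shows "has_improper_integral g I \<gamma>"
proof -
  obtain J where J: "\<forall>\<^sub>F N in at_top. (f has_contour_integral J N) (\<gamma> N)" "(J \<longlongrightarrow> I) at_top"
    using assms by (auto simp: has_improper_integral_def)
  have "\<forall>\<^sub>F N in at_top. (g has_contour_integral J N) (\<gamma> N)"
    using J(1) assms(2)
    by eventually_elim (rule has_contour_integral_eq, assumption, use assms(3) in blast)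
  then show ?thesis using J(2) by (auto simp: has_improper_integral_def)
qed

lemma has_improper_integral_real_reflect:
  assumes "has_improper_integral f I real_path"
  shows "has_improper_integral (\<lambda>w. f (- w)) I real_path"
proof -
  have "((\<lambda>w. f (- w)) has_contour_integral J) (real_path N)"
    if "(f has_contour_integral J) (real_path N)" for J N
  proof -
    have "(f has_contour_integral - J) (reversepath (real_path N))"
      using that by (intro has_contour_integral_reversepath) (auto simp: real_path_def)
    moreover have "uminus \<circ> reversepath (real_path N) = real_path N"
      by (auto simp: real_path_def reversepath_def linepath_def fun_eq_iff scaleR_conv_of_real algebra_simps)
    moreover have "valid_path (reversepath (real_path N))" by (simp add: real_path_def)
    ultimately show ?thesis
      using has_contour_integral_negatepath[of "reversepath (real_path N)" "\<lambda>w. f (- w)" J] by simp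
  qed
  then show ?thesis using assms unfolding has_improper_integral_def
    by (meson eventually_mono)
qed

lemma has_improper_integral_minus_path:
  assumes "has_improper_integral f I (plus_path \<rho>)"
  shows "has_improper_integral (\<lambda>w. f (- w)) (- I) (minus_path \<rho>)"
proof -
  have "((\<lambda>w. f (- w)) has_contour_integral - J) (minus_path \<rho> N)"
    if "(f has_contour_integral J) (plus_path \<rho> N)" for J N
    unfolding minus_path_eq using that
    by (intro has_contour_integral_negatepath valid_path_plus_path) simp
  moreover obtain J where "\<forall>\<^sub>F N in at_top. (f has_contour_integral J N) (plus_path \<rho> N)"
    "(J \<longlongrightarrow> I) at_top"
    using assms by (auto simp: has_improper_integral_def)
  ultimately show ?thesis unfolding has_improper_integral_def
    by (intro exI[of _ "\<lambda>N. - J N"] conjI tendsto_minus) (auto elim: eventually_mono)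
qed


section \<open>Cancellation of the three integrals\<close>

text \<open>Here \<open>A\<close>, \<open>B\<close>, \<open>C\<close> are the boundary data \<open>\<phi>'(0)\<close>, \<open>\<phi>(0)\<close>, \<open>\<phi>(1)\<close> as
  functions of time. The real integral is \<open>I + J\<close>, where \<open>I\<close> belongs to \<open>A\<close>, \<open>B\<close> and
  \<open>J\<close> to \<open>C\<close>; the upper contour contributes \<open>- I\<close> because of the sign of the remainder,
  the lower one \<open>- J\<close> because of its orientation.\<close>

lemma has_F_inverse_zero:
  assumes \<rho>: "\<rho> > 0" and t: "0 \<le> t" and x: "0 < x" "x < 1"
    and A: "\<And>s. s \<in> {0..t} \<Longrightarrow> (A has_vector_derivative A' s) (at s within {0..t})"
      "continuous_on {0..t} A'"
    and B: "\<And>s. s \<in> {0..t} \<Longrightarrow> (B has_vector_derivative B' s) (at s within {0..t})"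
      "continuous_on {0..t} B'"
    and C: "\<And>s. s \<in> {0..t} \<Longrightarrow> (C has_vector_derivative C' s) (at s within {0..t})"
      "continuous_on {0..t} C'"
    and real: "\<And>w. w \<in> \<real> \<Longrightarrow> f w =
      duhamel t A w + \<i> * w * duhamel t B w - \<i> * w * exp (- \<i> * w) * duhamel t C w"
    and plus: "\<And>w. w \<in> frontier (D_plus \<rho>) \<Longrightarrow> f w = - (duhamel t A w + \<i> * w * duhamel t B w)"
    and minus: "\<And>w. w \<in> frontier (D_minus \<rho>) \<Longrightarrow> f w = - \<i> * w * exp (- \<i> * w) * duhamel t C w"
  shows "has_F_inverse \<rho> f x 0"
proof -
  have cont: "continuous_on {0..t} A" "continuous_on {0..t} B" "continuous_on {0..t} C"
    using A(1) B(1) C(1) by (blast intro: continuous_on_vector_derivative)+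
  obtain cA where cA: "\<And>w. 0 \<le> Re (w\<^sup>2) \<Longrightarrow> norm (w\<^sup>2 * duhamel t A w) \<le> cA"
    using duhamel_decay[OF t A] by blast
  obtain cB where cB: "\<And>w. 0 \<le> Re (w\<^sup>2) \<Longrightarrow> norm (w\<^sup>2 * duhamel t B w) \<le> cB"
    using duhamel_decay[OF t B] by blast
  obtain cC where cC: "\<And>w. 0 \<le> Re (w\<^sup>2) \<Longrightarrow> norm (w\<^sup>2 * duhamel t C w) \<le> cC"
    using duhamel_decay[OF t C] by blast
  define P where "P = (\<lambda>w. duhamel t A w + \<i> * w * duhamel t B w)"
  define Q where "Q = (\<lambda>w. \<i> * w * duhamel t C w)"
  have hol: "P holomorphic_on UNIV" "Q holomorphic_on UNIV"
    unfolding P_def Q_def by (intro holomorphic_intros duhamel_holomorphic cont)+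
  have bP: "norm (w * P w) \<le> cA / \<rho> + cB" if w: "0 \<le> Re (w\<^sup>2)" "\<rho> \<le> norm w" for w
  proof -
    have "\<rho> * norm (w * duhamel t A w) \<le> norm w * norm (w * duhamel t A w)"
      using w by (intro mult_right_mono) auto
    also have "\<dots> \<le> cA" using cA[OF w(1)] by (simp add: norm_mult power2_eq_square)
    finally have "norm (w * duhamel t A w) \<le> cA / \<rho>" using \<rho> by (simp add: field_simps)
    moreover have "norm (\<i> * w\<^sup>2 * duhamel t B w) \<le> cB" using cB[OF w(1)] by (simp add: norm_mult)
    moreover have "w * P w = w * duhamel t A w + \<i> * w\<^sup>2 * duhamel t B w"
      by (simp add: P_def power2_eq_square algebra_simps)
    ultimately show ?thesis by (simp add: norm_triangle_le)
  qed
  have bQ: "norm (w * Q w) \<le> cC" if w: "0 \<le> Re (w\<^sup>2)" for w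
    using cC[OF w] by (simp add: Q_def norm_mult power2_eq_square)
  obtain I where I:
    "has_improper_integral (\<lambda>w. exp (\<i> * w * of_real x) * P w) I real_path"
    "has_improper_integral (\<lambda>w. exp (\<i> * w * of_real x) * P w) I (plus_path \<rho>)"
    using improper_integrals_agree[OF hol(1) \<rho> x(1) bP] by blast
  obtain J where J:
    "has_improper_integral (\<lambda>w. exp (\<i> * w * of_real (1 - x)) * Q w) J real_path"
    "has_improper_integral (\<lambda>w. exp (\<i> * w * of_real (1 - x)) * Q w) J (plus_path \<rho>)"
    using improper_integrals_agree[OF hol(2) \<rho>, of "1 - x" cC] x bQ by auto
  have reflect: "exp (\<i> * (- w) * of_real (1 - x)) * Q (- w) =
      exp (\<i> * w * of_real x) * (- \<i> * w * exp (- \<i> * w) * duhamel t C w)" for w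
  proof -
    have "exp (\<i> * (- w) * of_real (1 - x)) = exp (\<i> * w * of_real x) * exp (- \<i> * w)"
      by (simp add: algebra_simps flip: exp_add)
    then show ?thesis by (simp add: Q_def duhamel_even)
  qed
  have "has_improper_integral (\<lambda>w. exp (\<i> * w * of_real x) * f w) (I + J) real_path"
  proof (rule has_improper_integral_cong)
    show "has_improper_integral (\<lambda>w. exp (\<i> * w * of_real x) * P w
        + exp (\<i> * (- w) * of_real (1 - x)) * Q (- w)) (I + J) real_path"
      by (rule has_improper_integral_add[OF I(1) has_improper_integral_real_reflect[OF J(1)]])
    show "\<forall>\<^sub>F N in at_top. path_image (real_path N) \<subseteq> \<real>"
      by (intro always_eventually allI)
        (auto simp: real_path_def closed_segment_def complex_is_Real_iff)
    show "exp (\<i> * w * of_real x) * P w + exp (\<i> * (- w) * of_real (1 - x)) * Q (- w) =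
        exp (\<i> * w * of_real x) * f w" if "w \<in> \<real>" for w
      unfolding reflect real[OF that] P_def by (simp add: algebra_simps)
  qed
  moreover have "has_improper_integral (\<lambda>w. exp (\<i> * w * of_real x) * f w) (- I) (plus_path \<rho>)"
  proof (rule has_improper_integral_cong[OF has_improper_integral_neg[OF I(2)]])
    show "\<forall>\<^sub>F N in at_top. path_image (plus_path \<rho> N) \<subseteq> frontier (D_plus \<rho>)"
      using eventually_ge_at_top[of \<rho>] by eventually_elim (simp add: path_image_plus_path[OF \<rho>])
  qed (simp add: plus P_def algebra_simps)
  moreover have "has_improper_integral (\<lambda>w. exp (\<i> * w * of_real x) * f w) (- J) (minus_path \<rho>)"
  proof (rule has_improper_integral_cong[OF has_improper_integral_minus_path[OF J(2)]])
    show "\<forall>\<^sub>F N in at_top. path_image (minus_path \<rho> N) \<subseteq> frontier (D_minus \<rho>)"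
      using eventually_ge_at_top[of \<rho>] by eventually_elim (simp add: path_image_minus_path[OF \<rho>])
  qed (simp only: minus reflect)
  ultimately show ?thesis unfolding has_F_inverse_def by (intro exI conjI) auto
qed

lemma smooth_in_t_boundary_data:
  assumes "smooth_in_t T q" "t \<le> T"
  obtains A' B' C' where
    "\<And>s. s \<in> {0..t} \<Longrightarrow> ((\<lambda>s. D1 (\<lambda>x. q x s) 0) has_vector_derivative A' s) (at s within {0..t})"
    "\<And>s. s \<in> {0..t} \<Longrightarrow> ((\<lambda>s. q 0 s) has_vector_derivative B' s) (at s within {0..t})"
    "\<And>s. s \<in> {0..t} \<Longrightarrow> ((\<lambda>s. q 1 s) has_vector_derivative C' s) (at s within {0..t})"
    "continuous_on {0..t} A'" "continuous_on {0..t} B'" "continuous_on {0..t} C'"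
proof -
  obtain qx qt qtx where
    qx: "\<And>x s. x \<in> {0..1} \<Longrightarrow> s \<in> {0..T} \<Longrightarrow>
      ((\<lambda>x'. q x' s) has_vector_derivative qx x s) (at x within {0..1})" and
    qt: "\<And>x s. x \<in> {0..1} \<Longrightarrow> s \<in> {0..T} \<Longrightarrow>
      ((\<lambda>t'. q x t') has_vector_derivative qt x s) (at s within {0..T})" and
    qtx: "\<And>x s. x \<in> {0..1} \<Longrightarrow> s \<in> {0..T} \<Longrightarrow>
      ((\<lambda>t'. qx x t') has_vector_derivative qtx x s) (at s within {0..T})" and
    cont: "continuous_on ({0..1} \<times> {0..T}) (\<lambda>(x, t). qt x t)"
      "continuous_on ({0..1} \<times> {0..T}) (\<lambda>(x, t). qtx x t)"
    using assms(1) unfolding smooth_in_t_def by blast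
  have sub: "{0..t} \<subseteq> {0..T}" using assms(2) by auto
  have slice: "continuous_on {0..t} (h x)"
    if "continuous_on ({0..1} \<times> {0..T}) (\<lambda>(x, t). h x t)" "x \<in> {0..1}"
    for x :: real and h :: "real \<Rightarrow> real \<Rightarrow> complex"
  proof -
    have "continuous_on {0..t} (\<lambda>s. (x, s))" by (intro continuous_intros)
    moreover have "(\<lambda>s. (x, s)) ` {0..t} \<subseteq> {0..1} \<times> {0..T}" using that(2) sub by auto
    ultimately have "continuous_on {0..t} (\<lambda>s. case (x, s) of (x, s) \<Rightarrow> h x s)"
      by (rule continuous_on_compose2[OF that(1)])
    then show ?thesis by simp
  qed
  have D1: "D1 (\<lambda>x. q x s) 0 = qx 0 s" if "s \<in> {0..t}" for s
    unfolding D1_def using qx[of 0 s] that sub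
    by (intro vector_derivative_within_closed_interval) auto
  have "((\<lambda>s. D1 (\<lambda>x. q x s) 0) has_vector_derivative qtx 0 s) (at s within {0..t})"
    if s: "s \<in> {0..t}" for s
  proof (rule has_vector_derivative_transform[OF s])
    show "((\<lambda>s. qx 0 s) has_vector_derivative qtx 0 s) (at s within {0..t})"
      using qtx[of 0 s] s sub by (auto intro: has_vector_derivative_within_subset)
  qed (rule D1)
  moreover have "((\<lambda>s. q x s) has_vector_derivative qt x s) (at s within {0..t})"
    if "s \<in> {0..t}" "x \<in> {0..1}" for s x
    using qt[of x s] that sub by (auto intro: has_vector_derivative_within_subset)
  ultimately show ?thesis
    by (intro that[of "qtx 0" "qt 0" "qt 1"] slice cont) auto
qed

theorem theorem6:
  fixes K :: "real \<Rightarrow> real" and T \<rho> :: real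
  assumes "T > 0"
    and "C1_unit K"
    and "\<exists>\<delta>>0. \<forall>y\<in>{0..<\<delta>} \<inter> {0..1}. K y \<noteq> 0"
    and "\<rho> > 0"
    and "\<And>w. Delta K w = 0 \<Longrightarrow> \<bar>Im w\<bar> < \<rho> / sqrt 2"
  shows "\<exists>R :: (real \<Rightarrow> complex) \<Rightarrow> complex \<Rightarrow> complex.
    (\<forall>\<phi>\<in>Dom_L K. \<forall>w\<in>Contour \<rho>. F K \<rho> (L \<phi>) w = w\<^sup>2 * F K \<rho> \<phi> w + R \<phi> w) \<and>
    (\<forall>q :: real \<Rightarrow> real \<Rightarrow> complex.
      (\<forall>t\<in>{0..T}. (\<lambda>x. q x t) \<in> Dom_L K) \<and> smooth_in_t T q \<longrightarrow>
      (\<forall>t\<in>{0..T}. \<forall>x\<in>{0<..<1}.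
        has_F_inverse \<rho>
          (\<lambda>w. integral {0..t} (\<lambda>s. exp (w\<^sup>2 * of_real (s - t)) * R (\<lambda>x'. q x' s) w)) x 0))"
proof -
  have K: "continuous_on {0..1} K"
    using assms(2) by (simp add: C1_unit_def differentiable_imp_continuous_on)
  define R where "R = (\<lambda>\<phi> w. F K \<rho> (L \<phi>) w - w\<^sup>2 * F K \<rho> \<phi> w)"
  have "has_F_inverse \<rho>
      (\<lambda>w. integral {0..t} (\<lambda>s. exp (w\<^sup>2 * of_real (s - t)) * R (\<lambda>x'. q x' s) w)) x 0"
    if q: "\<And>t. t \<in> {0..T} \<Longrightarrow> (\<lambda>x. q x t) \<in> Dom_L K" "smooth_in_t T q"
      and t: "t \<in> {0..T}" and x: "x \<in> {0<..<1}" for q t x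
  proof -
    have tT: "0 \<le> t" "t \<le> T" and x01: "0 < x" "x < 1" using t x by auto
    define A B C where "A = (\<lambda>s. D1 (\<lambda>x. q x s) 0)" and "B = q 0" and "C = q 1"
    obtain A' B' C' where
      A: "\<And>s. s \<in> {0..t} \<Longrightarrow> (A has_vector_derivative A' s) (at s within {0..t})"
        "continuous_on {0..t} A'" and
      B: "\<And>s. s \<in> {0..t} \<Longrightarrow> (B has_vector_derivative B' s) (at s within {0..t})"
        "continuous_on {0..t} B'" and
      C: "\<And>s. s \<in> {0..t} \<Longrightarrow> (C has_vector_derivative C' s) (at s within {0..t})"
        "continuous_on {0..t} C'"
      using smooth_in_t_boundary_data[OF q(2) tT(2)] unfolding A_def B_def C_def by metis
    have cont: "continuous_on {0..t} A" "continuous_on {0..t} B" "continuous_on {0..t} C"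
      using A(1) B(1) C(1) by (blast intro: continuous_on_vector_derivative)+
    have dom: "(\<lambda>x. q x s) \<in> Dom_L K" if "s \<in> {0..t}" for s using q(1) that tT by auto
    have duhamel_R: "integral {0..t} (\<lambda>s. exp (w\<^sup>2 * of_real (s - t)) * R (\<lambda>x'. q x' s) w) =
        a * duhamel t A w + b * duhamel t B w + c * duhamel t C w"
      if "\<And>s. s \<in> {0..t} \<Longrightarrow> R (\<lambda>x'. q x' s) w = a * A s + b * B s + c * C s" for w a b c
    proof -
      have "integral {0..t} (\<lambda>s. exp (w\<^sup>2 * of_real (s - t)) * R (\<lambda>x'. q x' s) w) =
          duhamel t (\<lambda>s. a * A s + b * B s + c * C s) w"
        unfolding duhamel_def by (intro integral_cong) (simp add: that)
      also have "\<dots> = a * duhamel t A w + b * duhamel t B w + c * duhamel t C w"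
        by (simp add: duhamel_add duhamel_mult cont continuous_intros)
      finally show ?thesis .
    qed
    show ?thesis
    proof (rule has_F_inverse_zero[OF assms(4) tT(1) x01 A B C], goal_cases)
      case (4 w)
      then show ?case
        using duhamel_R[of w 1 "\<i> * w" "- \<i> * w * exp (- \<i> * w)"]
        by (simp add: R_def A_def B_def C_def remainder_real dom)
    next
      case (5 w)
      then show ?case
        using duhamel_R[of w "-1" "- \<i> * w" 0]
        by (simp add: R_def A_def B_def C_def remainder_plus[OF K assms(4,5)] dom)
    next
      case (6 w)
      then show ?case
        using duhamel_R[of w 0 0 "- \<i> * w * exp (- \<i> * w)"]
        by (simp add: R_def A_def B_def C_def remainder_minus[OF K assms(4,5)] dom)
    qed auto
  qed
  then show ?thesis by (intro exI[of _ R]) (auto simp: R_def)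
qed

end
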